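(* Let $u\in\mathcal{V}_0$. Assume that there is an admissible function of angles $(E,\eta)$ such that $$\lim_{t\to+\infty}u(te^{i\theta})/t^{\eta(\theta)}=0$$ for every $\theta\in E$. Then $u(z)=0$ for all $z\in\mathbb{H}$.
   Context: $\mathbb{H}=\{z\in\mathbb{C}:\operatorname{Im} z>0\}$ is the open upper half-plane; $\mathbb{Z}^+=\{1,2,3,\dots\}$. $\mathcal{V}_0$ is the set of all functions on $\mathbb{H}$ of the form $$u(z)=\sum_{k=0}^n c_k\,(\operatorname{Im} z)\,p_{k,0}(z),\qquad p_{k,0}(z)=\sum_{j=0}^k z^{k-j}\bar z^{\,j},\quad z\in\mathbb{H},$$ for some $n\in\{0,1,2,\dots\}$ and $c_0,\dots,c_n\in\mathbb{C}$. An admissible function of angles is a pair $(E,\eta)$ with $E\subset(0,\pi)$ a set and $\eta:E\to\mathbb{Z}^+$ a function such that for every $k\in\mathbb{Z}^+$ there exists $\theta\in E$ with $\sin(k\theta)\neq0$ and $k\geq\eta(\theta)$. *)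

theory Defs
  imports "HOL-Analysis.Analysis"
begin

definition upper_half_plane :: "complex set" where
  "upper_half_plane = {z. Im z > 0}"

definition p0 :: "nat \<Rightarrow> complex \<Rightarrow> complex" where
  "p0 k z = (\<Sum>j=0..k. z ^ (k - j) * cnj z ^ j)"

text \<open>
  A function on the upper half-plane is represented by a total function whose values off the
  half-plane are irrelevant; accordingly, membership in \<open>V0\<close> constrains only the
  values on the half-plane.
\<close>

definition V0 :: "(complex \<Rightarrow> complex) set" where
  "V0 = {u. \<exists>(n::nat) (c :: nat \<Rightarrow> complex). \<forall>z\<in>upper_half_plane.
              u z = (\<Sum>k=0..n. c k * complex_of_real (Im z) * p0 k z)}"

text \<open>Only the values of \<open>\<eta>\<close> on \<open>E\<close> matter.\<close>

definition admissible_angles :: "real set \<Rightarrow> (real \<Rightarrow> nat) \<Rightarrow> bool" where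
  "admissible_angles E \<eta> \<longleftrightarrow>
     E \<subseteq> {0<..<pi} \<and> (\<forall>\<theta>\<in>E. \<eta> \<theta> \<ge> 1) \<and>
     (\<forall>k::nat. k \<ge> 1 \<longrightarrow> (\<exists>\<theta>\<in>E. sin (real k * \<theta>) \<noteq> 0 \<and> k \<ge> \<eta> \<theta>))"

end

theory Submission
  imports Defs "HOL-Computational_Algebra.Polynomial"
begin

text \<open>
  Since \<open>(z - cnj z) * p0 k z = z ^ Suc k - cnj z ^ Suc k\<close>, the basis functions restrict to a ray
  as \<open>t ^ Suc k * sin (Suc k * \<theta>)\<close>. So \<open>u\<close> is a polynomial in \<open>t\<close> on each ray, and the growth
  condition kills its coefficients of degree at least \<open>\<eta> \<theta>\<close>; admissibility then provides for
  every \<open>k\<close> a ray on which this forces \<open>c k = 0\<close>.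
\<close>

lemma p0_telescope: "(z - cnj z) * p0 k z = z ^ Suc k - cnj z ^ Suc k"
proof -
  have "p0 k z = (\<Sum>j<Suc k. cnj z ^ j * z ^ (k - j))"
    unfolding p0_def by (rule sum.cong) (auto simp: mult.commute)
  then show ?thesis
    using diff_power_eq_sum[of "cnj z" k z] by (simp add: algebra_simps)
qed

text \<open>Apply \<open>w - cnj w = 2 * \<i> * Im w\<close> at \<open>w = z\<close> and at
  \<open>w = z ^ Suc k\<close>. Only the constant \<open>2 * \<i>\<close> is cancelled, so real
  \<open>z\<close> needs no separate case.\<close>

lemma Im_mult_p0: "complex_of_real (Im z) * p0 k z = complex_of_real (Im (z ^ Suc k))"
proof -
  have "2 * \<i> * (complex_of_real (Im z) * p0 k z) = (z - cnj z) * p0 k z"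
    by (simp add: complex_diff_cnj)
  also have "\<dots> = 2 * \<i> * complex_of_real (Im (z ^ Suc k))"
    unfolding p0_telescope
    by (simp add: complex_diff_cnj flip: complex_cnj_power del: power_Suc)
  finally show ?thesis by simp
qed

lemma Im_mult_p0_ray:
  fixes t \<theta> :: real
  defines "z \<equiv> complex_of_real t * exp (\<i> * complex_of_real \<theta>)"
  shows "complex_of_real (Im z) * p0 k z = complex_of_real (sin (real (Suc k) * \<theta>) * t ^ Suc k)"
proof -
  have "z = rcis t \<theta>"
    unfolding z_def rcis_def by (simp add: cis_conv_exp)
  then show ?thesis
    unfolding Im_mult_p0 by (simp add: DeMoivre2 mult.commute del: power_Suc of_nat_Suc)
qed

text \<open>A nonzero coefficient at some \<open>k \<ge> m\<close> forces
  \<open>degree p \<ge> m\<close>, so it is enough to refute a nonzero leading coefficient.\<close>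

lemma coeff_eq_0_if_tendsto_0:
  fixes p :: "complex poly"
  assumes lim: "((\<lambda>t::real. poly p (complex_of_real t) / complex_of_real t ^ m) \<longlongrightarrow> 0) at_top"
    and "m \<le> k"
  shows "coeff p k = 0"
proof (rule ccontr)
  assume "coeff p k \<noteq> 0"
  then have "k \<le> degree p" by (rule le_degree)
  with \<open>m \<le> k\<close> obtain d where d: "degree p = m + d"
    using le_Suc_ex le_trans by blast
  from filterlim_compose[OF poly_divide_tendsto_aux filterlim_of_real_at_infinity]
  have "((\<lambda>t. poly p (complex_of_real t) / complex_of_real t ^ degree p) \<longlongrightarrow> lead_coeff p) at_top" .
  \<comment> \<open>For \<open>t \<ge> 1\<close>, dividing by \<open>t ^ degree p\<close> instead of
    \<open>t ^ m\<close> can only shrink the norm.\<close>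
  moreover have "((\<lambda>t. poly p (complex_of_real t) / complex_of_real t ^ degree p) \<longlongrightarrow> 0) at_top"
  proof (rule Lim_null_comparison[OF _ tendsto_norm_zero[OF lim]])
    show "\<forall>\<^sub>F t in at_top. norm (poly p (complex_of_real t) / complex_of_real t ^ degree p)
            \<le> norm (poly p (complex_of_real t) / complex_of_real t ^ m)"
      using eventually_ge_at_top[of 1]
      by eventually_elim
        (auto simp: d norm_divide norm_power intro!: divide_left_mono power_increasing)
  qed
  ultimately have "lead_coeff p = 0"
    using tendsto_unique trivial_limit_at_top_linorder by blast
  with \<open>coeff p k \<noteq> 0\<close> show False by simp
qed

theorem theorem8p2:
  fixes u :: "complex \<Rightarrow> complex"
  assumes "u \<in> V0"
    and "\<exists>(E :: real set) (\<eta> :: real \<Rightarrow> nat). admissible_angles E \<eta> \<and>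
           (\<forall>\<theta>\<in>E. ((\<lambda>t::real. u (complex_of_real t * exp (\<i> * complex_of_real \<theta>))
                        / complex_of_real t ^ \<eta> \<theta>) \<longlongrightarrow> 0) at_top)"
  shows "\<forall>z\<in>upper_half_plane. u z = 0"
proof -
  obtain n c where u: "u z = (\<Sum>k=0..n. c k * complex_of_real (Im z) * p0 k z)"
    if "z \<in> upper_half_plane" for z
    using assms(1) unfolding V0_def by blast
  obtain E \<eta> where adm: "admissible_angles E \<eta>"
    and lim: "\<And>\<theta>. \<theta> \<in> E \<Longrightarrow>
      ((\<lambda>t::real. u (complex_of_real t * exp (\<i> * complex_of_real \<theta>))
          / complex_of_real t ^ \<eta> \<theta>) \<longlongrightarrow> 0) at_top"
    using assms(2) by blast
  have "c k = 0" if "k \<le> n" for k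
  proof -
    \<comment> \<open>Admissibility is used at \<open>Suc k\<close>, the exponent of
      \<open>t\<close> that accompanies \<open>c k\<close> on a ray.\<close>
    obtain \<theta> where \<theta>: "\<theta> \<in> E" "sin (real (Suc k) * \<theta>) \<noteq> 0" "\<eta> \<theta> \<le> Suc k"
      using adm unfolding admissible_angles_def by (metis One_nat_def Suc_le_mono le0)
    \<comment> \<open>The restriction of \<open>u\<close> to the ray at angle
      \<open>\<theta>\<close>, as a polynomial in \<open>t\<close>.\<close>
    define p where "p = (\<Sum>j=0..n. monom (c j * complex_of_real (sin (real (Suc j) * \<theta>))) (Suc j))"
    have "0 < \<theta>" "\<theta> < pi"
      using adm \<theta>(1) unfolding admissible_angles_def by auto
    have p: "u (complex_of_real t * exp (\<i> * complex_of_real \<theta>)) = poly p (complex_of_real t)"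
      if "t > 0" for t
    proof -
      have "complex_of_real t * exp (\<i> * complex_of_real \<theta>) \<in> upper_half_plane"
        using \<open>0 < \<theta>\<close> \<open>\<theta> < pi\<close> that
        by (simp add: upper_half_plane_def Im_exp sin_gt_zero)
      then show ?thesis
        by (simp only: u mult.assoc Im_mult_p0_ray)
          (simp add: p_def poly_sum poly_monom mult.assoc del: power_Suc of_nat_Suc)
    qed
    \<comment> \<open>\<open>u\<close> and \<open>p\<close> are known to agree only for
      \<open>t > 0\<close>, which suffices for a limit at infinity.\<close>
    have "((\<lambda>t. poly p (complex_of_real t) / complex_of_real t ^ \<eta> \<theta>) \<longlongrightarrow> 0) at_top"
      using lim[OF \<theta>(1)]
      by (rule Lim_transform_eventually)
        (use eventually_gt_at_top[of 0] in \<open>eventually_elim, simp add: p\<close>)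
    then have "coeff p (Suc k) = 0"
      using \<theta>(3) by (rule coeff_eq_0_if_tendsto_0)
    \<comment> \<open>The monomials of \<open>p\<close> have distinct degrees, so \<open>c k\<close>
      is isolated; \<open>k \<le> n\<close> ensures that its term occurs.\<close>
    moreover have "coeff p (Suc k) = c k * complex_of_real (sin (real (Suc k) * \<theta>))"
      using that by (simp add: p_def coeff_sum coeff_monom del: of_nat_Suc)
    ultimately show "c k = 0"
      using \<theta>(2) by (simp del: of_nat_Suc)
  qed
  then show ?thesis by (simp add: u)
qed

end
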